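(* Let $F$ be a one-dimensional permutive CA on $S^{\mathbb{Z}}$ and let $\theta$ be a positive permutation noise on $S$. Then the PCA resulting from perturbing $F$ with the noise $\theta$ is uniformly ergodic with the uniform Bernoulli measure on $S^{\mathbb{Z}}$ as its unique invariant measure.
   Context: Let $S$ be a finite set and $\mathcal{X}=S^{\mathbb{Z}}$ with the product topology. For finite $K\subseteq\mathbb{Z}$ and $y_K\in S^K$, the cylinder $[y_K]$ is $\{x\in\mathcal{X}: x_k=y_k\ \forall k\in K\}$. The uniform Bernoulli measure is the product measure with uniform marginals on $S$. A CA with neighbourhood $\{\ell,\ell+1,\dots,r\}\subseteq\mathbb{Z}$ and local rule $f:S^m\to S$, $m=r-\ell+1\ge2$, is the map $(Fx)_k=f(x_{k+\ell},\dots,x_{k+r})$. $F$ is left-permutive (resp. right-permutive) if for every $w\in S^{m-1}$ the map $a\mapsto f(aw)$ (resp. $a\mapsto f(wa)$) is a bijection of $S$. $F$ is permutive if it is left-permutive or right-permutive. A permutation noise is a stochastic matrix $\theta(a,b)=\sum_{\varsigma\in\mathrm{Sym}(S)}q(\varsigma)\,\delta_{\varsigma(a)}(b)$, where $q$ is a probability distribution on the set $\mathrm{Sym}(S)$ of permutations of $S$ (equivalently, $\theta$ is doubly stochastic). It is positive if $\theta(a,b)>0$ for all $a,b\in S$. The perturbed PCA is the Markov kernel $\Phi$ on $\mathcal{X}$ given by $\Phi(x,[y_K])=\prod_{k\in K}\theta\big((Fx)_k,y_k\big)$ for every cylinder. A Borel probability measure $\pi$ is invariant if $\pi\Phi=\pi$.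 $\Phi$ is uniformly ergodic if it has a unique invariant measure $\pi$ and $\Phi^t(x,[u])\to\pi([u])$ as $t\to\infty$, uniformly in $x\in\mathcal{X}$, for each cylinder $[u]$. *)

theory Defs
  imports "HOL-Probability.Probability"
begin

section \<open>Configurations\<close>

text \<open>The finite alphabet is a type \<open>'s :: finite\<close> and configurations are functions
  \<open>int \<Rightarrow> 's\<close>. The space of configurations carries the product of the discrete
  \<open>\<sigma>\<close>-algebras; \<open>sets_config_space\<close> below identifies it with the Borel
  \<open>\<sigma>\<close>-algebra of the product topology.\<close>

definition config_space :: "(int \<Rightarrow> 's::finite) measure" where
  "config_space = (\<Pi>\<^sub>M k\<in>(UNIV :: int set). count_space UNIV)"

text \<open>Only the values of \<open>y\<close> on \<open>K\<close> matter.\<close>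

definition cylinder :: "int set \<Rightarrow> (int \<Rightarrow> 's) \<Rightarrow> (int \<Rightarrow> 's) set" where
  "cylinder K y = {x. \<forall>k\<in>K. x k = y k}"

definition uniform_bernoulli :: "(int \<Rightarrow> 's::finite) measure" where
  "uniform_bernoulli = (\<Pi>\<^sub>M k\<in>(UNIV :: int set). measure_pmf (pmf_of_set UNIV))"


section \<open>Cellular automata\<close>

text \<open>A local rule takes words, that is lists over \<open>'s\<close>; only its values on words of length
  \<open>m = r - l + 1\<close> are relevant.\<close>

definition ca :: "int \<Rightarrow> int \<Rightarrow> ('s list \<Rightarrow> 's) \<Rightarrow> (int \<Rightarrow> 's) \<Rightarrow> (int \<Rightarrow> 's)" where
  "ca l r f x = (\<lambda>k. f (map (\<lambda>i. x (k + i)) [l..r]))"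

definition left_permutive :: "int \<Rightarrow> int \<Rightarrow> ('s list \<Rightarrow> 's) \<Rightarrow> bool" where
  "left_permutive l r f \<longleftrightarrow> (\<forall>w. int (length w) = r - l \<longrightarrow> bij (\<lambda>a. f (a # w)))"

definition right_permutive :: "int \<Rightarrow> int \<Rightarrow> ('s list \<Rightarrow> 's) \<Rightarrow> bool" where
  "right_permutive l r f \<longleftrightarrow> (\<forall>w. int (length w) = r - l \<longrightarrow> bij (\<lambda>a. f (w @ [a])))"

definition permutive :: "int \<Rightarrow> int \<Rightarrow> ('s list \<Rightarrow> 's) \<Rightarrow> bool" where
  "permutive l r f \<longleftrightarrow> left_permutive l r f \<or> right_permutive l r f"


section \<open>Noise and probabilistic cellular automata\<close>

text \<open>A stochastic matrix on \<open>'s\<close> is a function \<open>\<theta> :: 's \<Rightarrow> 's pmf\<close>, with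
  entries \<open>\<theta>(a,b) = pmf (\<theta> a) b\<close>.\<close>

definition permutation_noise :: "('s::finite \<Rightarrow> 's pmf) \<Rightarrow> bool" where
  "permutation_noise \<theta> \<longleftrightarrow>
     (\<exists>q :: ('s \<Rightarrow> 's) pmf. set_pmf q \<subseteq> {\<sigma>. bij \<sigma>} \<and>
        (\<forall>a b. pmf (\<theta> a) b = (\<Sum>\<sigma> | bij \<sigma>. pmf q \<sigma> * (if b = \<sigma> a then 1 else 0))))"

definition positive_noise :: "('s \<Rightarrow> 's pmf) \<Rightarrow> bool" where
  "positive_noise \<theta> \<longleftrightarrow> (\<forall>a b. pmf (\<theta> a) b > 0)"

text \<open>The perturbation of \<open>F\<close> by \<open>\<theta>\<close>: given \<open>x\<close>, the new symbols are
  independent, the one at \<open>k\<close> having law \<open>\<theta>((F x)\<^sub>k, \<cdot>)\<close>. See \<open>measure_pca_cylinder\<close>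
  for the values on cylinders and \<open>measurable_pca\<close> for the kernel property.\<close>

definition pca ::
  "((int \<Rightarrow> 's::finite) \<Rightarrow> (int \<Rightarrow> 's)) \<Rightarrow> ('s \<Rightarrow> 's pmf) \<Rightarrow> (int \<Rightarrow> 's) \<Rightarrow> (int \<Rightarrow> 's) measure" where
  "pca F \<theta> x = (\<Pi>\<^sub>M k\<in>(UNIV :: int set). measure_pmf (\<theta> (F x k)))"

primrec kernel_power ::
  "((int \<Rightarrow> 's::finite) \<Rightarrow> (int \<Rightarrow> 's) measure) \<Rightarrow> nat \<Rightarrow> (int \<Rightarrow> 's) \<Rightarrow> (int \<Rightarrow> 's) measure" where
  "kernel_power \<Phi> 0 x = return config_space x"
| "kernel_power \<Phi> (Suc t) x = kernel_power \<Phi> t x \<bind> \<Phi>"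

text \<open>The bind of the Giry monad, \<open>\<pi> \<bind> \<Phi>\<close>, is the measure
  \<open>\<pi>\<Phi>\<close>, that is \<open>A \<mapsto> \<integral> \<Phi>(x, A) \<pi>(dx)\<close>.\<close>

definition invariant_measure ::
  "((int \<Rightarrow> 's::finite) \<Rightarrow> (int \<Rightarrow> 's) measure) \<Rightarrow> (int \<Rightarrow> 's) measure \<Rightarrow> bool" where
  "invariant_measure \<Phi> \<pi> \<longleftrightarrow> prob_space \<pi> \<and> sets \<pi> = sets config_space \<and> \<pi> \<bind> \<Phi> = \<pi>"

definition uniformly_ergodic :: "((int \<Rightarrow> 's::finite) \<Rightarrow> (int \<Rightarrow> 's) measure) \<Rightarrow> bool" where
  "uniformly_ergodic \<Phi> \<longleftrightarrow>
     (\<exists>\<pi>. invariant_measure \<Phi> \<pi> \<and> (\<forall>\<pi>'. invariant_measure \<Phi> \<pi>' \<longrightarrow> \<pi>' = \<pi>) \<and>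
        (\<forall>K u. finite K \<longrightarrow>
           uniform_limit UNIV (\<lambda>t x. measure (kernel_power \<Phi> t x) (cylinder K u))
             (\<lambda>x. measure \<pi> (cylinder K u)) sequentially))"


section \<open>Agreement with the usual descriptions\<close>

lemma space_config_space [simp]: "space config_space = UNIV"
  by (simp add: config_space_def space_PiM)

lemma sets_PiM_pmf: "sets (\<Pi>\<^sub>M k\<in>(UNIV :: int set). measure_pmf (p k)) = sets config_space"
  unfolding config_space_def by (rule sets_PiM_cong) auto

lemma sets_pca [simp, measurable_cong]: "sets (pca F \<theta> x) = sets config_space"
  unfolding pca_def by (rule sets_PiM_pmf)

lemma sets_uniform_bernoulli [simp, measurable_cong]:
  "sets uniform_bernoulli = sets config_space"
  unfolding uniform_bernoulli_def by (rule sets_PiM_pmf)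

lemma prob_space_pca: "prob_space (pca F \<theta> x)"
  unfolding pca_def by (intro prob_space_PiM measure_pmf.prob_space_axioms)

lemma prob_space_uniform_bernoulli: "prob_space uniform_bernoulli"
  unfolding uniform_bernoulli_def by (intro prob_space_PiM measure_pmf.prob_space_axioms)

lemma cylinder_in_sets: "finite K \<Longrightarrow> cylinder K y \<in> sets config_space"
proof -
  assume K: "finite K"
  have "{x \<in> space (config_space :: (int \<Rightarrow> 'a) measure). \<forall>k\<in>K. x k = y k} \<in> sets config_space"
    unfolding config_space_def using K by measurable
  then show ?thesis by (simp add: cylinder_def)
qed

lemma measure_PiM_pmf_cylinder:
  assumes "finite K"
  shows "measure (\<Pi>\<^sub>M k\<in>(UNIV :: int set). measure_pmf (p k)) (cylinder K y)
         = (\<Prod>k\<in>K. pmf (p k) (y k))"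
proof -
  interpret product_prob_space "\<lambda>k. measure_pmf (p k)" "UNIV :: int set" ..
  have "cylinder K y = prod_emb UNIV (\<lambda>k. measure_pmf (p k)) K (\<Pi>\<^sub>E k\<in>K. {y k})"
    by (auto simp: cylinder_def prod_emb_def PiE_iff)
  with measure_PiM_emb[of K "\<lambda>k. {y k}"] assms show ?thesis
    by (simp add: measure_pmf_single)
qed

lemma measure_pca_cylinder:
  "finite K \<Longrightarrow> measure (pca F \<theta> x) (cylinder K y) = (\<Prod>k\<in>K. pmf (\<theta> (F x k)) (y k))"
  unfolding pca_def by (rule measure_PiM_pmf_cylinder)

lemma measure_uniform_bernoulli_cylinder:
  fixes y :: "int \<Rightarrow> 's::finite"
  shows "finite K \<Longrightarrow> measure uniform_bernoulli (cylinder K y) = (1 / real CARD('s)) ^ card K"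
  unfolding uniform_bernoulli_def by (simp add: measure_PiM_pmf_cylinder)

lemma measurable_word:
  "(\<lambda>x. map (\<lambda>i. x (k + i)) xs) \<in> config_space \<rightarrow>\<^sub>M count_space (UNIV :: 's::finite list set)"
proof (induction xs)
  case (Cons a xs)
  have c: "(\<lambda>x. x (k + a)) \<in> config_space \<rightarrow>\<^sub>M count_space (UNIV :: 's set)"
    unfolding config_space_def by measurable
  have "(\<lambda>x. (\<lambda>b x. b # map (\<lambda>i. x (k + i)) xs) (x (k + a)) x)
      \<in> config_space \<rightarrow>\<^sub>M count_space (UNIV :: 's list set)"
    by (rule measurable_compose_countable[OF _ c])
       (rule measurable_compose[OF Cons.IH], simp)
  then show ?case by simp
qed simp

lemma measurable_ca_component:
  "(\<lambda>x. ca l r f x k) \<in> config_space \<rightarrow>\<^sub>M count_space (UNIV :: 's::finite set)"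
  unfolding ca_def by (rule measurable_compose[OF measurable_word]) simp

lemma measurable_pca: "pca (ca l r f) \<theta> \<in> config_space \<rightarrow>\<^sub>M prob_algebra config_space"
proof (rule measurable_prob_algebra_generated)
  let ?G = "prod_algebra (UNIV :: int set) (\<lambda>_. count_space (UNIV :: 'a set))"
  show "sets config_space = sigma_sets UNIV ?G"
    by (simp add: config_space_def sets_PiM)
  show "Int_stable ?G" by (rule Int_stable_prod_algebra)
  show "?G \<subseteq> Pow UNIV" by simp
  fix A assume "A \<in> ?G"
  then obtain J E where A: "A = prod_emb UNIV (\<lambda>_. count_space UNIV) J (Pi\<^sub>E J E)" and J: "finite J"
    by (elim prod_algebraE) (rule that)
  have "emeasure (pca (ca l r f) \<theta> x) A = (\<Prod>k\<in>J. emeasure (measure_pmf (\<theta> (ca l r f x k))) (E k))"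
    for x
  proof -
    have "A = prod_emb UNIV (\<lambda>k. measure_pmf (\<theta> (ca l r f x k))) J (Pi\<^sub>E J E)"
      by (simp add: A prod_emb_def)
    then show ?thesis unfolding pca_def
      using J by (simp only:) (rule emeasure_PiM_emb, auto intro: measure_pmf.prob_space_axioms)
  qed
  moreover have "(\<lambda>x. \<Prod>k\<in>J. emeasure (measure_pmf (\<theta> (ca l r f x k))) (E k))
      \<in> borel_measurable config_space"
    by (intro borel_measurable_prod_ennreal measurable_compose[OF measurable_ca_component]) simp
  ultimately show "(\<lambda>x. emeasure (pca (ca l r f) \<theta> x) A) \<in> borel_measurable config_space"
    by simp
qed (simp_all add: prob_space_pca)

lemma sets_config_space:
  "sets (config_space :: (int \<Rightarrow> 's::finite) measure) =
     sigma_sets UNIV {U. openin (product_topology (\<lambda>_. discrete_topology UNIV) UNIV) U}"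
    (is "_ = sigma_sets UNIV {U. openin ?T U}")
proof
  have "sigma_sets UNIV {{f :: int \<Rightarrow> 's. f i \<in> A} | i A. True} \<subseteq> sigma_sets UNIV {U. openin ?T U}"
  proof (rule sigma_sets_mono', safe)
    fix i :: int and A :: "'s set"
    have "openin ?T {f \<in> topspace ?T. f i \<in> A}"
      by (rule openin_continuous_map_preimage[OF continuous_map_product_projection]) auto
    then show "openin ?T {f. f i \<in> A}" by simp
  qed
  then show "sets config_space \<subseteq> sigma_sets UNIV {U. openin ?T U}"
    by (simp add: config_space_def sets_PiM_single)
next
  have "U \<in> sets config_space" if U: "openin ?T U" for U :: "(int \<Rightarrow> 's) set"
  proof -
    let ?C = "\<lambda>n x. cylinder {-int n..int n} x"
    let ?D = "\<lambda>n. (\<lambda>x. ?C n x) ` {x. ?C n x \<subseteq> U}"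
    have fin: "finite (?D n)" for n
    proof (rule finite_subset)
      show "?D n \<subseteq> ?C n ` ({-int n..int n} \<rightarrow>\<^sub>E UNIV)"
      proof safe
        fix x :: "int \<Rightarrow> 's"
        have "?C n x = ?C n (restrict x {-int n..int n})" by (auto simp: cylinder_def)
        then show "?C n x \<in> ?C n ` ({-int n..int n} \<rightarrow>\<^sub>E UNIV)" by auto
      qed
    qed (intro finite_imageI finite_PiE, auto)
    have "x \<in> (\<Union>n. \<Union> (?D n))" if x: "x \<in> U" for x
    proof -
      obtain V where V: "finite {i. V i \<noteq> (UNIV :: 's set)}" "x \<in> Pi\<^sub>E UNIV V" "Pi\<^sub>E UNIV V \<subseteq> U"
        using product_topology_open_contains_basis[OF U x]
        unfolding topspace_discrete_topology by blast
      obtain n :: nat where n: "{i. V i \<noteq> UNIV} \<subseteq> {-int n..int n}"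
      proof -
        let ?n = "nat (\<Sum>i | V i \<noteq> UNIV. abs i)"
        have "i \<in> {-int ?n..int ?n}" if i: "V i \<noteq> UNIV" for i
        proof -
          have "abs i \<le> (\<Sum>i | V i \<noteq> UNIV. abs i)"
            by (rule member_le_sum) (use V(1) i in auto)
          then show ?thesis by (simp add: abs_le_iff)
        qed
        then have "{i. V i \<noteq> UNIV} \<subseteq> {-int ?n..int ?n}" by blast
        then show ?thesis by (rule that)
      qed
      have "?C n x \<subseteq> Pi\<^sub>E UNIV V"
      proof safe
        fix z i assume z: "z \<in> ?C n x"
        show "z i \<in> V i"
        proof (cases "V i = UNIV")
          case False
          with n have "i \<in> {-int n..int n}" by auto
          with z have "z i = x i" by (simp add: cylinder_def)
          with V(2) show ?thesis by auto
        qed simp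
      qed simp
      moreover have "x \<in> ?C n x" by (simp add: cylinder_def)
      moreover note V(3)
      ultimately show ?thesis
        by (intro UN_I[of n] UnionI[of "?C n x"] imageI CollectI) (auto intro: order_trans)
    qed
    then have "U \<subseteq> (\<Union>n. \<Union> (?D n))" by (rule subsetI)
    moreover have "(\<Union>n. \<Union> (?D n)) \<subseteq> U"
      by (intro UN_least Union_least) (elim imageE, hypsubst, erule CollectD)
    ultimately have "(\<Union>n. \<Union> (?D n)) = U" by (rule antisym[rotated])
    moreover have "(\<Union>n. \<Union> (?D n)) \<in> sets config_space"
    proof (rule sets.countable_nat_UN, rule image_subsetI)
      fix n
      show "\<Union> (?D n) \<in> sets config_space"
        by (rule sets.finite_Union[OF fin]) (auto intro: cylinder_in_sets)
    qed
    ultimately show ?thesis by (rule subst)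
  qed
  then show "sigma_sets UNIV {U. openin ?T U} \<subseteq> sets (config_space :: (int \<Rightarrow> 's) measure)"
    using sets.sigma_sets_subset[of "{U. openin ?T U}" config_space]
    unfolding space_config_space by blast
qed

end

theory Submission
  imports Defs
begin

text \<open>Say that the rule is permutive at the far end of its neighbourhood, at distance \<open>d\<close>.
  Call an observable \<open>g\<close> centered at \<open>k\<close> if it sees no coordinate beyond \<open>k\<close> and averages to
  zero over the value at \<open>k\<close>. One step of the PCA sends \<open>g\<close> to an observable centered at
  \<open>k + d\<close>: varying the input at \<open>k + d\<close> permutes the noiseless symbol at \<open>k\<close> and affects no
  earlier site, and the columns of \<open>\<theta>\<close> sum to one. As the entries of \<open>\<theta>\<close> are at least
  \<open>\<epsilon> > 0\<close>, subtracting \<open>\<epsilon>\<close> from them does not change the image of \<open>g\<close>, so its sup norm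
  shrinks by the factor \<open>1 - card S * \<epsilon>\<close>. Up to its uniform measure, the indicator of a cylinder
  is a sum of \<open>card K\<close> centered observables, which gives exponential convergence, uniformly in
  the initial configuration.\<close>


section \<open>Integration against product measures on configurations\<close>

text \<open>Two cylinders that share a point \<open>x\<close> intersect in the cylinder of
  \<open>x\<close> over the union of their index sets. With the empty set added, cylinders thus form
  a pi-system, and it generates the sigma-algebra because the alphabet is finite.\<close>

lemma measure_eqI_cylinder:
  fixes M N :: "(int \<Rightarrow> 's::finite) measure"
  assumes "prob_space M" "prob_space N"
    and sets: "sets M = sets config_space" "sets N = sets config_space"
    and eq: "\<And>K y. finite K \<Longrightarrow> measure M (cylinder K y) = measure N (cylinder K y)"
  shows "M = N"
proof -
  interpret M: prob_space M by fact
  interpret N: prob_space N by fact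
  let ?E = "insert {} {cylinder K y | K (y :: int \<Rightarrow> 's). finite K}"
  have "cylinder K y \<inter> cylinder L z \<in> ?E" if "finite K" "finite L"
    for K L :: "int set" and y z :: "int \<Rightarrow> 's"
  proof (cases "cylinder K y \<inter> cylinder L z = {}")
    case False
    then obtain x where "x \<in> cylinder K y" "x \<in> cylinder L z" by blast
    then have "cylinder K y \<inter> cylinder L z = cylinder (K \<union> L) x"
      by (auto simp: cylinder_def)
    with that show ?thesis by blast
  qed simp
  then have stable: "Int_stable ?E" unfolding Int_stable_def by blast
  have gen: "sets (config_space :: (int \<Rightarrow> 's) measure) = sigma_sets UNIV ?E"
  proof
    have "{g :: int \<Rightarrow> 's. g i \<in> A} \<in> sigma_sets UNIV ?E" for i A
    proof -
      interpret sigma_algebra UNIV "sigma_sets UNIV ?E" by (rule sigma_algebra_sigma_sets) simp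
      have "{g :: int \<Rightarrow> 's. g i \<in> A} = (\<Union>a\<in>A. cylinder {i} (\<lambda>_. a))"
        by (auto simp: cylinder_def)
      also have "\<dots> \<in> sigma_sets UNIV ?E"
        by (intro finite_UN) (auto intro!: sigma_sets.Basic)
      finally show ?thesis .
    qed
    then show "sets config_space \<subseteq> sigma_sets UNIV ?E"
      by (simp add: config_space_def sets_PiM_single) (rule sigma_sets_mono, blast)
    have "?E \<subseteq> sets config_space" using cylinder_in_sets by auto
    then show "sigma_sets UNIV ?E \<subseteq> sets config_space"
      using sets.sigma_sets_subset[of ?E config_space] by simp
  qed
  show ?thesis
  proof (rule measure_eqI_generator_eq[OF stable _ _ _ _, where \<Omega> = UNIV and A = "\<lambda>_. UNIV"])
    show "emeasure M X = emeasure N X" if "X \<in> ?E" for X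
      using that eq by (auto simp: M.emeasure_eq_measure N.emeasure_eq_measure)
    have "UNIV = cylinder {} (undefined :: int \<Rightarrow> 's)" by (simp add: cylinder_def)
    then show "range (\<lambda>_ :: nat. UNIV) \<subseteq> ?E" by blast
  qed (simp_all add: sets gen)
qed

text \<open>A function that is not integrable has integral 0 by convention, and the bound itself
  forces \<open>0 \<le> c\<close>; hence the estimate covers every function bounded by
  \<open>c\<close>.\<close>

lemma abs_integral_le:
  assumes "prob_space M" and "\<And>x. \<bar>g x\<bar> \<le> (c :: real)"
  shows "\<bar>integral\<^sup>L M g\<bar> \<le> c"
proof -
  interpret prob_space M by fact
  have "0 \<le> c" using assms(2) by (meson abs_ge_zero order_trans)
  have "\<bar>integral\<^sup>L M g\<bar> \<le> (\<integral>x. \<bar>g x\<bar> \<partial>M)" by (rule integral_abs_bound)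
  also have "\<dots> \<le> (\<integral>x. c \<partial>M)"
    by (rule integral_mono_AE') (use assms \<open>0 \<le> c\<close> in auto)
  finally show ?thesis by (simp add: prob_space)
qed

abbreviation pmf_product :: "(int \<Rightarrow> 's pmf) \<Rightarrow> (int \<Rightarrow> 's::finite) measure" where
  "pmf_product p \<equiv> \<Pi>\<^sub>M k\<in>(UNIV :: int set). measure_pmf (p k)"

lemma prob_space_pmf_product: "prob_space (pmf_product p)"
  by (intro prob_space_PiM measure_pmf.prob_space_axioms)

lemma measurable_pmf_product:
  "measurable (pmf_product p) N = measurable config_space N"
  by (rule measurable_cong_sets[OF sets_PiM_pmf refl])

text \<open>Overwriting all coordinates outside \<open>A\<close> by a constant does not change
  \<open>g\<close>, and it maps both product measures to the same measure.\<close>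

lemma integral_pmf_product_cong:
  fixes g :: "(int \<Rightarrow> 's::finite) \<Rightarrow> real"
  assumes p: "\<And>j. j \<in> A \<Longrightarrow> p j = p' j"
    and g: "g \<in> borel_measurable config_space" "\<And>x y. (\<forall>j\<in>A. x j = y j) \<Longrightarrow> g x = g y"
  shows "(\<integral>y. g y \<partial>pmf_product p) = (\<integral>y. g y \<partial>pmf_product p')"
proof -
  define \<rho> :: "(int \<Rightarrow> 's) \<Rightarrow> int \<Rightarrow> 's" where "\<rho> y = (\<lambda>j. if j \<in> A then y j else undefined)" for y
  have \<rho>: "\<rho> \<in> config_space \<rightarrow>\<^sub>M config_space"
  proof -
    have "(\<lambda>y. \<rho> y j) \<in> config_space \<rightarrow>\<^sub>M count_space UNIV" for j
      unfolding \<rho>_def config_space_def by (cases "j \<in> A") auto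
    then show ?thesis unfolding config_space_def[where 's='s] by (intro measurable_PiM_single') auto
  qed
  have \<rho>': "\<rho> \<in> pmf_product q \<rightarrow>\<^sub>M config_space" for q
    using \<rho> by (simp add: measurable_pmf_product)
  \<comment> \<open>After \<open>\<rho>\<close> every site outside \<open>A\<close> carries the
    symbol \<open>undefined\<close>. A cylinder prescribing anything else there has empty preimage;
    otherwise only the sites in \<open>K \<inter> A\<close> constrain the preimage.\<close>
  have *: "measure (distr (pmf_product q) config_space \<rho>) (cylinder K u) =
      (if \<forall>k\<in>K - A. u k = undefined then \<Prod>k\<in>K \<inter> A. pmf (q k) (u k) else 0)" if "finite K" for q K u
  proof -
    have "\<rho> -` cylinder K u =
        (if \<forall>k\<in>K - A. u k = undefined then cylinder (K \<inter> A) u else {})"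
      by (auto simp: \<rho>_def cylinder_def)
    then show ?thesis using that
      by (simp add: measure_distr[OF \<rho>' cylinder_in_sets] space_PiM measure_PiM_pmf_cylinder)
  qed
  have eq: "distr (pmf_product p) config_space \<rho> = distr (pmf_product p') config_space \<rho>"
    by (rule measure_eqI_cylinder)
       (auto simp: * p intro!: prob_space.prob_space_distr prob_space_pmf_product \<rho>' prod.cong)
  have "(\<integral>y. g y \<partial>pmf_product q) = (\<integral>y. g y \<partial>distr (pmf_product q) config_space \<rho>)" for q
    unfolding integral_distr[OF \<rho>' g(1)]
    by (rule arg_cong[where f = "integral\<^sup>L _"]) (auto simp: \<rho>_def intro!: g(2))
  then show ?thesis by (simp add: eq)
qed

lemma measurable_config_update:
  assumes "h \<in> M \<rightarrow>\<^sub>M config_space" "a \<in> M \<rightarrow>\<^sub>M count_space UNIV"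
  shows "(\<lambda>x. (h x)(k := a x)) \<in> M \<rightarrow>\<^sub>M config_space"
  using assms unfolding config_space_def by (intro measurable_fun_upd[where J = UNIV]) auto

text \<open>Replacing the symbol at \<open>k\<close> by an independent draw from \<open>p k\<close>
  preserves the product measure; Fubini then integrates out the draw.\<close>

lemma integral_pmf_product_resample:
  fixes g :: "(int \<Rightarrow> 's::finite) \<Rightarrow> real"
  assumes g: "g \<in> borel_measurable config_space" and bd: "\<And>x. \<bar>g x\<bar> \<le> c"
  shows "(\<integral>y. g y \<partial>pmf_product p) = (\<integral>y. (\<Sum>a\<in>UNIV. pmf (p k) a * g (y(k := a))) \<partial>pmf_product p)"
proof -
  let ?M = "pmf_product p" and ?p = "measure_pmf (p k)"
  let ?u = "\<lambda>(y, a). y(k := a)"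
  interpret M: prob_space ?M by (rule prob_space_pmf_product)
  interpret pair_sigma_finite ?M ?p ..
  interpret P: pair_prob_space ?M ?p ..
  have fst: "fst \<in> ?M \<Otimes>\<^sub>M ?p \<rightarrow>\<^sub>M config_space"
    using measurable_fst[of ?M ?p] by (simp add: measurable_cong_sets[OF refl sets_PiM_pmf])
  have u: "?u \<in> ?M \<Otimes>\<^sub>M ?p \<rightarrow>\<^sub>M config_space"
    using measurable_config_update[OF fst, of snd k] by (simp add: case_prod_beta)
  have "distr (?M \<Otimes>\<^sub>M ?p) config_space ?u = ?M"
  proof (rule measure_eqI_cylinder)
    fix K :: "int set" and y :: "int \<Rightarrow> 's" assume K: "finite K"
    \<comment> \<open>The constraint at \<open>k\<close> falls on the fresh symbol, all the others
      on the old configuration, so the preimage is a rectangle.\<close>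
    have "?u -` cylinder K y = cylinder (K - {k}) y \<times> (if k \<in> K then {y k} else UNIV)"
      by (auto simp: cylinder_def) metis+
    then have "measure (distr (?M \<Otimes>\<^sub>M ?p) config_space ?u) (cylinder K y)
        = measure (?M \<Otimes>\<^sub>M ?p) (cylinder (K - {k}) y \<times> (if k \<in> K then {y k} else UNIV))"
      using K by (simp add: measure_distr[OF u cylinder_in_sets] space_pair_measure space_PiM)
    also have "\<dots> = measure ?M (cylinder (K - {k}) y) * measure ?p (if k \<in> K then {y k} else UNIV)"
      using K unfolding measure_def
      by (subst measure_pmf.emeasure_pair_measure_Times)
         (auto simp: sets_PiM_pmf cylinder_in_sets enn2real_mult)
    also have "\<dots> = measure ?M (cylinder K y)"
      using K by (auto simp: measure_PiM_pmf_cylinder measure_pmf_single prod.remove)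
    finally show "measure (distr (?M \<Otimes>\<^sub>M ?p) config_space ?u) (cylinder K y) = measure ?M (cylinder K y)" .
  qed (auto intro!: P.prob_space_distr u M.prob_space_axioms sets_PiM_pmf)
  then have "(\<integral>y. g y \<partial>?M) = (\<integral>z. g (?u z) \<partial>(?M \<Otimes>\<^sub>M ?p))"
    using integral_distr[OF u g] by simp
  also have "\<dots> = (\<integral>y. (\<integral>a. g (y(k := a)) \<partial>?p) \<partial>?M)"
    using P.integrable_const_bound[of "\<lambda>z. g (?u z)" c] measurable_compose[OF u g] bd
    by (subst integral_fst'[symmetric]) auto
  also have "\<dots> = (\<integral>y. (\<Sum>a\<in>UNIV. pmf (p k) a * g (y(k := a))) \<partial>?M)"
    by (simp add: integral_measure_pmf_real[of UNIV] mult.commute)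
  finally show ?thesis .
qed


section \<open>Centered observables and one step of the PCA\<close>

text \<open>The sign of \<open>s\<close> selects the direction: positive for right-permutive rules, negative for
  left-permutive ones.\<close>

definition edge_centered :: "int \<Rightarrow> int \<Rightarrow> real \<Rightarrow> ((int \<Rightarrow> 's::finite) \<Rightarrow> real) \<Rightarrow> bool" where
  "edge_centered s k c g \<longleftrightarrow> g \<in> borel_measurable config_space \<and> (\<forall>x. \<bar>g x\<bar> \<le> c) \<and>
     (\<forall>x y. (\<forall>j. s * j \<le> s * k \<longrightarrow> x j = y j) \<longrightarrow> g x = g y) \<and>
     (\<forall>x. (\<Sum>a\<in>UNIV. g (x(k := a))) = 0)"

text \<open>Stated for the global map instead of the local rule, so that a single argument serves
  both directions; \<open>k + d\<close> is the furthest site that the symbol at \<open>k\<close>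
  depends on.\<close>

definition edge_permutive :: "int \<Rightarrow> int \<Rightarrow> ((int \<Rightarrow> 's) \<Rightarrow> (int \<Rightarrow> 's)) \<Rightarrow> bool" where
  "edge_permutive s d F \<longleftrightarrow>
     (\<forall>k x y. (\<forall>j. s * j \<le> s * (k + d) \<longrightarrow> x j = y j) \<longrightarrow> F x k = F y k) \<and>
     (\<forall>k x. bij (\<lambda>a. F (x(k + d := a)) k))"

text \<open>The witnesses are \<open>s = -1\<close>, \<open>d = l\<close> for a left-permutive rule
  and \<open>s = 1\<close>, \<open>d = r\<close> for a right-permutive one. Splitting the word at
  that end isolates the symbol being varied.\<close>

lemma edge_permutive_ca:
  fixes f :: "'s list \<Rightarrow> 's"
  assumes "l < r" "permutive l r f"
  obtains s d where "s \<noteq> 0" "edge_permutive s d (ca l r f)"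
proof -
  consider "left_permutive l r f" | "right_permutive l r f"
    using assms(2) unfolding permutive_def by blast
  then show thesis
  proof cases
    case 1
    have "[l..r] = l # [l+1..r]" using assms(1) by (simp add: upto_rec1)
    then have "ca l r f (x(k + l := a)) k = f (a # map (\<lambda>i. x (k + i)) [l+1..r])" for x k a
      by (auto simp: ca_def intro!: arg_cong[where f = f])
    then have "bij (\<lambda>a. ca l r f (x(k + l := a)) k)" for x k
      using 1 assms(1) by (simp add: left_permutive_def)
    moreover have "ca l r f x k = ca l r f y k" if "\<forall>j. - 1 * j \<le> - 1 * (k + l) \<longrightarrow> x j = y j" for x y k
      using that unfolding ca_def by (intro arg_cong[where f = f] map_cong) auto
    ultimately show thesis by (intro that[of "-1" l]) (auto simp: edge_permutive_def)
  next
    case 2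
    have "[l..r] = [l..r-1] @ [r]" using assms(1) by (simp add: upto_rec2)
    then have "ca l r f (x(k + r := a)) k = f (map (\<lambda>i. x (k + i)) [l..r-1] @ [a])" for x k a
      by (auto simp: ca_def intro!: arg_cong[where f = f])
    then have "bij (\<lambda>a. ca l r f (x(k + r := a)) k)" for x k
      using 2 assms(1) by (simp add: right_permutive_def)
    moreover have "ca l r f x k = ca l r f y k" if "\<forall>j. 1 * j \<le> 1 * (k + r) \<longrightarrow> x j = y j" for x y k
      using that unfolding ca_def by (intro arg_cong[where f = f] map_cong) auto
    ultimately show thesis by (intro that[of 1 r]) (auto simp: edge_permutive_def)
  qed
qed

text \<open>After exchanging the sums, each permutation contributes its full weight, since it sends
  exactly one symbol to \<open>b\<close>.\<close>

lemma permutation_noise_column_sum: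
  assumes "permutation_noise \<theta>"
  shows "(\<Sum>a\<in>UNIV. pmf (\<theta> a) b) = 1"
proof -
  obtain q :: "('a \<Rightarrow> 'a) pmf" where q: "set_pmf q \<subseteq> {\<sigma>. bij \<sigma>}"
    and \<theta>: "\<And>a b. pmf (\<theta> a) b = (\<Sum>\<sigma> | bij \<sigma>. pmf q \<sigma> * (if b = \<sigma> a then 1 else 0))"
    using assms unfolding permutation_noise_def by blast
  have "(\<Sum>a\<in>UNIV. pmf (\<theta> a) b)
      = (\<Sum>\<sigma> | bij \<sigma>. pmf q \<sigma> * (\<Sum>a\<in>UNIV. if b = \<sigma> a then 1 else 0))"
    unfolding \<theta> sum_distrib_left by (rule sum.swap)
  also have "\<dots> = (\<Sum>\<sigma> | bij \<sigma>. pmf q \<sigma>)"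
  proof (rule sum.cong[OF refl])
    fix \<sigma> :: "'a \<Rightarrow> 'a" assume "\<sigma> \<in> {\<sigma>. bij \<sigma>}"
    then have "(\<Sum>a\<in>UNIV. if b = \<sigma> a then 1 else 0 :: real) = (\<Sum>a\<in>UNIV. if b = a then 1 else 0)"
      using sum.reindex_bij_betw[of \<sigma> UNIV UNIV "\<lambda>a. if b = a then 1 else 0 :: real"] by simp
    then show "pmf q \<sigma> * (\<Sum>a\<in>UNIV. if b = \<sigma> a then 1 else 0) = pmf q \<sigma>" by simp
  qed
  also have "\<dots> = 1" by (rule sum_pmf_eq_1[OF _ q]) simp
  finally show ?thesis .
qed

text \<open>The contraction estimate behind both uniqueness and convergence. Averaging out site
  \<open>k\<close> first isolates the only factor that depends on the input at
  \<open>k + d\<close>.\<close>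

lemma edge_centered_pca:
  fixes \<theta> :: "'s::finite \<Rightarrow> 's pmf" and \<epsilon> :: real
  assumes s: "s \<noteq> 0" and F: "edge_permutive s d F"
    and meas: "pca F \<theta> \<in> config_space \<rightarrow>\<^sub>M prob_algebra config_space"
    and col: "\<And>b. (\<Sum>a\<in>UNIV. pmf (\<theta> a) b) = 1"
    and \<epsilon>: "\<And>a b. \<epsilon> \<le> pmf (\<theta> a) b"
    and g: "edge_centered s k c g"
  shows "edge_centered s (k + d) ((1 - CARD('s) * \<epsilon>) * c) (\<lambda>x. \<integral>y. g y \<partial>pca F \<theta> x)"
proof -
  have g_meas [measurable]: "g \<in> borel_measurable config_space" and g_bd: "\<And>x. \<bar>g x\<bar> \<le> c"
    and g_dep: "\<And>x y. (\<forall>j. s * j \<le> s * k \<longrightarrow> x j = y j) \<Longrightarrow> g x = g y"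
    and g_sum: "\<And>x. (\<Sum>a\<in>UNIV. g (x(k := a))) = 0"
    using g unfolding edge_centered_def by blast+
  have F_dep: "\<And>k x y. (\<forall>j. s * j \<le> s * (k + d) \<longrightarrow> x j = y j) \<Longrightarrow> F x k = F y k"
    and F_bij: "\<And>k x. bij (\<lambda>a. F (x(k + d := a)) k)"
    using F unfolding edge_permutive_def by blast+
  \<comment> \<open>\<open>h b\<close> is \<open>g\<close> with site \<open>k\<close> averaged under
    the noise applied to the noiseless symbol \<open>b\<close>; it no longer depends on the
    coordinate \<open>k\<close>.\<close>
  define h where "h b y = (\<Sum>a\<in>UNIV. pmf (\<theta> b) a * g (y(k := a)))" for b y
  have h_meas: "h b \<in> borel_measurable config_space" for b
    unfolding h_def
    by (intro borel_measurable_sum borel_measurable_times measurable_const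
        measurable_compose[OF measurable_config_update g_meas]) auto
  have h_bd: "\<bar>h b y\<bar> \<le> (1 - CARD('s) * \<epsilon>) * c" for b y
  proof -
    \<comment> \<open>Centering makes the subtracted constant \<open>\<epsilon>\<close> invisible;
      the remaining weights are nonnegative with total
      \<open>1 - CARD('s) * \<epsilon>\<close>.\<close>
    have "h b y = (\<Sum>a\<in>UNIV. (pmf (\<theta> b) a - \<epsilon>) * g (y(k := a)))"
      using g_sum[of y] by (simp add: h_def left_diff_distrib sum_subtractf flip: sum_distrib_left)
    also have "\<bar>\<dots>\<bar> \<le> (\<Sum>a\<in>UNIV. (pmf (\<theta> b) a - \<epsilon>) * c)"
      by (intro order_trans[OF sum_abs] sum_mono)
         (simp add: abs_mult \<epsilon> g_bd mult_left_mono)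
    also have "\<dots> = (1 - CARD('s) * \<epsilon>) * c"
      by (simp add: sum_subtractf sum_pmf_eq_1 flip: sum_distrib_right)
    finally show ?thesis .
  qed
  have h_dep: "h b x = h b y" if "\<forall>j. s * j \<le> s * k \<and> j \<noteq> k \<longrightarrow> x j = y j" for b x y
    unfolding h_def
    by (intro sum.cong arg_cong2[where f = "(*)"] refl g_dep) (use that in auto)
  have int_g: "(\<integral>y. g y \<partial>pca F \<theta> x) = (\<integral>y. h (F x k) y \<partial>pca F \<theta> x)" for x
    unfolding pca_def h_def by (rule integral_pmf_product_resample[OF g_meas g_bd])
  have "(\<lambda>x. \<integral>y. g y \<partial>pca F \<theta> x) \<in> borel_measurable config_space"
    by (rule measurable_compose[OF measurable_prob_algebraD[OF meas]
          integral_measurable_subprob_algebra[OF g_meas]])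
  moreover have "\<bar>\<integral>y. g y \<partial>pca F \<theta> x\<bar> \<le> (1 - CARD('s) * \<epsilon>) * c" for x
    unfolding int_g by (rule abs_integral_le[OF prob_space_pca h_bd])
  moreover have "(\<integral>z. g z \<partial>pca F \<theta> x) = (\<integral>z. g z \<partial>pca F \<theta> y)"
    if xy: "\<forall>j. s * j \<le> s * (k + d) \<longrightarrow> x j = y j" for x y
    unfolding pca_def
  proof (rule integral_pmf_product_cong[where A = "{j. s * j \<le> s * k}"])
    fix j assume "j \<in> {j. s * j \<le> s * k}"
    then have "F x j = F y j"
      using xy by (intro F_dep) (auto simp: distrib_left)
    then show "\<theta> (F x j) = \<theta> (F y j)" by simp
  qed (auto intro: g_dep)
  moreover have "(\<Sum>b\<in>UNIV. \<integral>y. g y \<partial>pca F \<theta> (x(k + d := b))) = 0" for x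
  proof -
    interpret prob_space "pca F \<theta> x" by (rule prob_space_pca)
    let ?x = "\<lambda>b. x(k + d := b)"
    \<comment> \<open>\<open>h c\<close> reads only sites strictly before \<open>k\<close> in the
      direction of \<open>s\<close>, and the noiseless symbols there do not see the input at
      \<open>k + d\<close>. So varying \<open>b\<close> acts solely through the index
      \<open>F (?x b) k\<close>.\<close>
    have "(\<integral>y. h c y \<partial>pca F \<theta> (?x b)) = (\<integral>y. h c y \<partial>pca F \<theta> x)" for b c
      unfolding pca_def
    proof (rule integral_pmf_product_cong[where A = "{j. s * j \<le> s * k \<and> j \<noteq> k}"])
      fix j assume "j \<in> {j. s * j \<le> s * k \<and> j \<noteq> k}"
      then have "s * j < s * k" using s by (simp add: less_le)
      then have "F (?x b) j = F x j"
        by (intro F_dep) (auto simp: distrib_left)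
      then show "\<theta> (F (?x b) j) = \<theta> (F x j)" by simp
    qed (auto intro: h_dep h_meas)
    then have "(\<Sum>b\<in>UNIV. \<integral>y. g y \<partial>pca F \<theta> (?x b)) = (\<Sum>b\<in>UNIV. \<integral>y. h (F (?x b) k) y \<partial>pca F \<theta> x)"
      by (simp only: int_g)
    \<comment> \<open>Permutivity makes that index run over every symbol exactly once.\<close>
    also have "\<dots> = (\<Sum>b\<in>UNIV. \<integral>y. h b y \<partial>pca F \<theta> x)"
      by (rule sum.reindex_bij_betw[OF F_bij])
    also have "\<dots> = (\<integral>y. (\<Sum>b\<in>UNIV. h b y) \<partial>pca F \<theta> x)"
    proof (rule Bochner_Integration.integral_sum[symmetric])
      show "integrable (pca F \<theta> x) (h b)" for b
        by (rule integrable_const_bound[where B = "(1 - CARD('s) * \<epsilon>) * c"])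
           (use h_bd h_meas in \<open>auto simp: measurable_cong_sets[OF sets_pca refl]\<close>)
    qed
    also have "\<dots> = 0"
    proof -
      \<comment> \<open>Unit column sums reduce this to the plain sum of \<open>g\<close> over the
        symbol at \<open>k\<close>, which vanishes by centering.\<close>
      have "(\<Sum>b\<in>UNIV. h b y) = (\<Sum>a\<in>UNIV. (\<Sum>b\<in>UNIV. pmf (\<theta> b) a) * g (y(k := a)))" for y
        unfolding h_def sum_distrib_right by (rule sum.swap)
      then have "(\<Sum>b\<in>UNIV. h b y) = 0" for y by (simp add: col g_sum)
      then show ?thesis by simp
    qed
    finally show ?thesis .
  qed
  ultimately show ?thesis unfolding edge_centered_def by blast
qed

text \<open>Resampling site \<open>k\<close> uniformly produces precisely the average that centering
  sets to zero.\<close>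

lemma edge_centered_integral_uniform_bernoulli:
  assumes "edge_centered s k c g"
  shows "(\<integral>x. g x \<partial>uniform_bernoulli) = 0"
proof -
  have "(\<integral>x. g x \<partial>uniform_bernoulli) =
      (\<integral>x. (\<Sum>a\<in>UNIV. pmf (pmf_of_set UNIV) a * g (x(k := a))) \<partial>uniform_bernoulli)"
    unfolding uniform_bernoulli_def
    by (rule integral_pmf_product_resample) (use assms in \<open>auto simp: edge_centered_def\<close>)
  also have "\<dots> = 0"
    using assms by (simp add: edge_centered_def flip: sum_distrib_left sum_divide_distrib)
  finally show ?thesis .
qed

section \<open>Cylinder probabilities from centered observables\<close>

text \<open>Adding a site to the cylinder should divide its measure by \<open>CARD('s)\<close>; the
  discrepancy is the integral of one centered observable, so each site costs at most
  \<open>D\<close>.\<close>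

lemma cylinder_measure_bound:
  fixes M :: "(int \<Rightarrow> 's::finite) measure" and D :: real
  assumes M: "prob_space M" "sets M = sets config_space" and s: "s \<noteq> 0"
    and D: "\<And>k g. edge_centered s k 1 g \<Longrightarrow> \<bar>\<integral>x. g x \<partial>M\<bar> \<le> D"
    and K: "finite K"
  shows "\<bar>measure M (cylinder K u) - (1 / CARD('s)) ^ card K\<bar> \<le> card K * D"
  using K
\<comment> \<open>Sites are added in the direction of \<open>s\<close>, so that the new site
  \<open>k\<close> is the furthest one and the observable \<open>g\<close> below sees nothing beyond
  it.\<close>
proof (induction K rule: finite_ranking_induct[where f = "\<lambda>j. s * j"])
  case empty
  interpret prob_space M by fact
  have "space M = UNIV" using sets_eq_imp_space_eq[OF M(2)] by simp
  then have "measure M UNIV = 1" using prob_space by simp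
  then show ?case by (simp add: cylinder_def)
next
  case (insert k K)
  interpret prob_space M by fact
  show ?case
  proof (cases "k \<in> K")
    case True
    with insert show ?thesis by (simp add: insert_absorb)
  next
    case False
    let ?n = "real CARD('s)"
    define i where "i x = (indicator (cylinder K u) x :: real)" for x
    \<comment> \<open>The second factor is the indicator of the prescribed symbol at
      \<open>k\<close> minus its uniform mean, which centers \<open>g\<close> at
      \<open>k\<close>.\<close>
    define g where "g x = i x * ((if x k = u k then 1 else 0) - 1 / ?n)" for x
    have cyl: "cylinder K u \<in> sets config_space" "cylinder (insert k K) u \<in> sets config_space"
      using insert.hyps by (simp_all add: cylinder_in_sets)
    have g_eq: "g x = indicator (cylinder (insert k K) u) x - i x / ?n" for x
      by (auto simp: g_def i_def cylinder_def indicator_def)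
    have g_meas: "g \<in> borel_measurable config_space"
      unfolding g_eq[abs_def] i_def using cyl by (intro borel_measurable_diff borel_measurable_divide) auto
    have n1: "1 \<le> ?n" using zero_less_card_finite[where 'a='s] by linarith
    have "edge_centered s k 1 g"
      unfolding edge_centered_def
    proof (intro conjI allI impI)
      show "\<bar>g x\<bar> \<le> 1" for x
        by (auto simp: g_def i_def indicator_def abs_le_iff divide_simps; use n1 in linarith)
      show "g x = g y" if "\<forall>j. s * j \<le> s * k \<longrightarrow> x j = y j" for x y
        using that insert.hyps(2) by (auto simp: g_def i_def indicator_def cylinder_def)
      have "i (x(k := a)) = i x" for x a
        using False by (auto simp: i_def indicator_def cylinder_def)
      then show "(\<Sum>a\<in>UNIV. g (x(k := a))) = 0" for x
        by (simp add: g_def sum_subtractf flip: sum_distrib_left)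
    qed (rule g_meas)
    then have "\<bar>\<integral>x. g x \<partial>M\<bar> \<le> D" by (rule D)
    moreover have "(\<integral>x. g x \<partial>M) = measure M (cylinder (insert k K) u) - measure M (cylinder K u) / ?n"
      unfolding g_eq i_def using cyl M(2) sets_eq_imp_space_eq[OF M(2)]
      by (subst Bochner_Integration.integral_diff)
         (auto intro!: integrable_real_indicator integrable_divide simp: less_top[symmetric])
    moreover have "\<bar>measure M (cylinder K u) / ?n - (1 / ?n) ^ card K / ?n\<bar> \<le> card K * D"
    proof -
      have "\<bar>measure M (cylinder K u) / ?n - (1 / ?n) ^ card K / ?n\<bar>
          = \<bar>measure M (cylinder K u) - (1 / ?n) ^ card K\<bar> / ?n"
        by (simp flip: diff_divide_distrib)
      also have "\<dots> \<le> \<bar>measure M (cylinder K u) - (1 / ?n) ^ card K\<bar>"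
        using n1 by (simp add: divide_le_eq mult_le_cancel_left1)
      finally show ?thesis using insert.IH by linarith
    qed
    ultimately show ?thesis
      using False insert.hyps(1) by (simp add: distrib_right)
  qed
qed


section \<open>Invariance, uniqueness and uniform convergence\<close>

text \<open>The witness is the least entry of the finite matrix. Comparison with a row sum gives the
  last bound, which keeps the contraction factor nonnegative.\<close>

lemma positive_noise_lower_bound:
  fixes \<theta> :: "'s::finite \<Rightarrow> 's pmf"
  assumes "positive_noise \<theta>"
  obtains \<epsilon> :: real where "0 < \<epsilon>" "\<And>a b. \<epsilon> \<le> pmf (\<theta> a) b" "CARD('s) * \<epsilon> \<le> 1"
proof -
  let ?P = "range (\<lambda>(a, b). pmf (\<theta> a) b)"
  define \<epsilon> where "\<epsilon> = Min ?P"
  have "0 < \<epsilon>"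
    using assms unfolding \<epsilon>_def positive_noise_def by (subst Min_gr_iff) auto
  moreover have le: "\<epsilon> \<le> pmf (\<theta> a) b" for a b
    unfolding \<epsilon>_def by (rule Min_le) auto
  moreover have "CARD('s) * \<epsilon> \<le> (\<Sum>b\<in>UNIV. pmf (\<theta> undefined) b)"
    using sum_mono[of UNIV "\<lambda>_. \<epsilon>" "pmf (\<theta> undefined)"] le by simp
  then have "CARD('s) * \<epsilon> \<le> 1" by (simp add: sum_pmf_eq_1)
  ultimately show thesis by (rule that)
qed

lemma integral_bind_prob_algebra:
  fixes g :: "'b \<Rightarrow> real"
  assumes M: "prob_space M" "sets M = sets N" and \<Phi>: "\<Phi> \<in> N \<rightarrow>\<^sub>M prob_algebra L"
    and g: "g \<in> borel_measurable L" and bd: "\<And>x. \<bar>g x\<bar> \<le> c"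
  shows "(\<integral>x. g x \<partial>(M \<bind> \<Phi>)) = (\<integral>x. (\<integral>y. g y \<partial>\<Phi> x) \<partial>M)"
proof (rule integral_bind[OF g bd, where B' = 1])
  show "\<Phi> \<in> M \<rightarrow>\<^sub>M subprob_algebra L"
    using measurable_prob_algebraD[OF \<Phi>] by (simp add: measurable_cong_sets[OF M(2) refl])
  then show "AE x in M. emeasure (\<Phi> x) (space (\<Phi> x)) \<le> ennreal 1"
    by (auto intro!: AE_I2 subprob_space.emeasure_space_le_1 dest: subprob_space_kernel)
  show "finite_measure M" using M(1) by (rule prob_space.finite_measure)
qed

text \<open>This is the case \<open>D = 0\<close> of the cylinder estimate.\<close>

lemma uniform_bernoulli_eqI:
  fixes M :: "(int \<Rightarrow> 's::finite) measure"
  assumes M: "prob_space M" "sets M = sets config_space" and s: "s \<noteq> 0"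
    and 0: "\<And>k g. edge_centered s k 1 g \<Longrightarrow> (\<integral>x. g x \<partial>M) = 0"
  shows "M = uniform_bernoulli"
proof (rule measure_eqI_cylinder[OF M(1) prob_space_uniform_bernoulli M(2) sets_uniform_bernoulli])
  fix K :: "int set" and y :: "int \<Rightarrow> 's" assume "finite K"
  then show "measure M (cylinder K y) = measure uniform_bernoulli (cylinder K y)"
    using cylinder_measure_bound[OF M s, of 0 K y] 0
    by (simp add: measure_uniform_bernoulli_cylinder)
qed

theorem theorem3p16:
  fixes l r :: int
    and f :: "'s::finite list \<Rightarrow> 's"
    and \<theta> :: "'s \<Rightarrow> 's pmf"
  assumes "l < r"
    and "permutive l r f"
    and "permutation_noise \<theta>"
    and "positive_noise \<theta>"
  shows "uniformly_ergodic (pca (ca l r f) \<theta>) \<and>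
    (\<forall>\<pi>. invariant_measure (pca (ca l r f) \<theta>) \<pi> \<longleftrightarrow> \<pi> = uniform_bernoulli)"
proof -
  let ?F = "ca l r f"
  let ?\<Phi> = "pca ?F \<theta>"
  let ?U = "uniform_bernoulli :: (int \<Rightarrow> 's) measure"
  obtain s d where s: "s \<noteq> 0" and F: "edge_permutive s d ?F"
    using assms(1,2) by (rule edge_permutive_ca)
  obtain \<epsilon> :: real where \<epsilon>: "0 < \<epsilon>" "\<And>a b. \<epsilon> \<le> pmf (\<theta> a) b" "CARD('s) * \<epsilon> \<le> 1"
    using assms(4) by (rule positive_noise_lower_bound) blast
  define \<delta> where "\<delta> = 1 - CARD('s) * \<epsilon>"
  have \<delta>: "0 \<le> \<delta>" "\<delta> < 1" using \<epsilon> by (simp_all add: \<delta>_def)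
  note meas = measurable_pca[of l r f \<theta>]
  have step: "edge_centered s (k + d) (\<delta> * c) (\<lambda>x. \<integral>y. g y \<partial>?\<Phi> x)" if "edge_centered s k c g" for k c g
    unfolding \<delta>_def
    by (rule edge_centered_pca[OF s F meas permutation_noise_column_sum[OF assms(3)] \<epsilon>(2) that])
  have bind: "(\<integral>x. g x \<partial>(M \<bind> ?\<Phi>)) = (\<integral>x. (\<integral>y. g y \<partial>?\<Phi> x) \<partial>M)"
    if "prob_space M" "sets M = sets config_space" "edge_centered s k c g" for M k c g
    by (rule integral_bind_prob_algebra[OF that(1,2) meas])
       (use that(3) in \<open>auto simp: edge_centered_def\<close>)
  have bind_space: "prob_space (M \<bind> ?\<Phi>)" "sets (M \<bind> ?\<Phi>) = sets config_space"
    if "prob_space M" "sets M = sets config_space" for M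
    using that prob_space_bind'[OF _ meas, of M] sets_bind'[OF _ meas, of M]
    by (simp_all add: space_prob_algebra)
  have decay: "tendsto (\<lambda>t. C * \<delta> ^ t) 0 sequentially" for C
    using \<delta> by (intro tendsto_mult_right_zero LIMSEQ_realpow_zero)

  \<comment> \<open>One step keeps observables centered, and the uniform measure annihilates all
    centered observables; hence so does its image under the kernel.\<close>
  have inv: "?U \<bind> ?\<Phi> = ?U"
    using bind_space[OF prob_space_uniform_bernoulli sets_uniform_bernoulli] s
  proof (rule uniform_bernoulli_eqI)
    fix k and g :: "(int \<Rightarrow> 's) \<Rightarrow> real" assume g: "edge_centered s k 1 g"
    show "(\<integral>x. g x \<partial>(?U \<bind> ?\<Phi>)) = 0"
      using bind[OF prob_space_uniform_bernoulli sets_uniform_bernoulli g]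
        edge_centered_integral_uniform_bernoulli[OF step[OF g]] by simp
  qed

  have unique: "\<pi> = ?U" if "invariant_measure ?\<Phi> \<pi>" for \<pi>
  proof -
    have \<pi>: "prob_space \<pi>" "sets \<pi> = sets config_space" "\<pi> \<bind> ?\<Phi> = \<pi>"
      using that unfolding invariant_measure_def by auto
    \<comment> \<open>By invariance \<open>g\<close> may be replaced by its image under one step,
      which is centered at \<open>k + d\<close> with bound \<open>\<delta> * c\<close>; hence
      \<open>k\<close>, \<open>c\<close> and \<open>g\<close> must vary in the induction.\<close>
    have *: "\<bar>\<integral>x. g x \<partial>\<pi>\<bar> \<le> c * \<delta> ^ t" if "edge_centered s k c g" for k c g t
      using that
    proof (induction t arbitrary: k c g)
      case 0
      then show ?case using \<pi>(1) by (auto simp: edge_centered_def intro: abs_integral_le)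
    next
      case (Suc t)
      from Suc.IH[OF step[OF Suc.prems]] bind[OF \<pi>(1,2) Suc.prems] show ?case
        by (simp add: \<pi>(3) mult_ac)
    qed
    have "(\<integral>x. g x \<partial>\<pi>) = 0" if "edge_centered s k 1 g" for k g
    proof -
      have "\<bar>\<integral>x. g x \<partial>\<pi>\<bar> \<le> 0"
        by (rule LIMSEQ_le_const[OF decay[of 1]]) (use *[OF that] in auto)
      then show ?thesis by simp
    qed
    then show ?thesis by (rule uniform_bernoulli_eqI[OF \<pi>(1,2) s])
  qed

  have power_space: "prob_space (kernel_power ?\<Phi> t x)" "sets (kernel_power ?\<Phi> t x) = sets config_space"
    for t x
    by (induction t) (simp_all add: bind_space prob_space_return)
  \<comment> \<open>The last step of the power is the one integrated against \<open>g\<close> first,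
    so the induction hypothesis applies to the image of \<open>g\<close>. The bound does not involve
    \<open>x\<close>, which yields uniformity.\<close>
  have power_bound: "\<bar>\<integral>y. g y \<partial>kernel_power ?\<Phi> t x\<bar> \<le> c * \<delta> ^ t" if "edge_centered s k c g" for k c g t x
    using that
  proof (induction t arbitrary: k c g)
    case 0
    then show ?case by (simp add: edge_centered_def integral_return)
  next
    case (Suc t)
    from Suc.IH[OF step[OF Suc.prems]] bind[OF power_space Suc.prems, of t x] show ?case
      by (simp add: mult_ac)
  qed
  have "uniform_limit UNIV (\<lambda>t x. measure (kernel_power ?\<Phi> t x) (cylinder K u))
      (\<lambda>x. measure ?U (cylinder K u)) sequentially" if K: "finite K" for K u
  proof (rule uniform_limitI)
    fix e :: real assume "0 < e"
    with decay[of "card K"] have "\<forall>\<^sub>F t in sequentially. card K * \<delta> ^ t < e"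
      by (rule order_tendstoD)
    then show "\<forall>\<^sub>F t in sequentially. \<forall>x\<in>UNIV.
        dist (measure (kernel_power ?\<Phi> t x) (cylinder K u)) (measure ?U (cylinder K u)) < e"
    proof eventually_elim
      case (elim t)
      \<comment> \<open>The cylinder estimate is used with \<open>D = \<delta> ^ t\<close>.\<close>
      have "dist (measure (kernel_power ?\<Phi> t x) (cylinder K u)) (measure ?U (cylinder K u)) \<le> card K * \<delta> ^ t" for x
        using cylinder_measure_bound[OF power_space[of t x] s power_bound[where c = 1] K, where u = u]
        by (simp add: measure_uniform_bernoulli_cylinder K dist_real_def)
      with elim show ?case by (auto intro: le_less_trans)
    qed
  qed
  moreover have "invariant_measure ?\<Phi> ?U"
    by (simp add: invariant_measure_def inv prob_space_uniform_bernoulli)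
  ultimately show ?thesis
    using unique unfolding uniformly_ergodic_def by blast
qed

end
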